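(* Let $\Gamma=(\mathcal{Y},\mathcal{X},L,\mathrm{I},\eta,\epsilon,\mathcal{E})$ be a Galois structure. If $\mathcal{X}$ is strongly $\mathcal{E}$-Birkhoff in $\mathcal{Y}$, then $\Gamma$-coverings are stable under quotients along double extensions: if $\alpha\colon f_A\to f_B$ is an $\mathcal{E}$-double extension and $f_A$ is a $\Gamma$-covering, then $f_B$ is a $\Gamma$-covering.
   Context: **Double extensions.** For a category $\mathcal{Y}$ with a class $\mathcal{E}$ of morphisms (called extensions), a commutative square $\alpha=(\alpha_\top,\alpha_\perp)\colon f_A\to f_B$, with $f_A\colon A_\top\to A_\perp$, $f_B\colon B_\top\to B_\perp$, $f_B\circ\alpha_\top=\alpha_\perp\circ f_A$, is an $\mathcal{E}$-double extension when $\alpha_\top,\alpha_\perp,f_A,f_B$, the projections of the pullback $A_\perp\times_{B_\perp}B_\top$, and the comparison map $A_\top\to A_\perp\times_{B_\perp}B_\top$ are all in $\mathcal{E}$. **Galois structures.** A Galois structure $\Gamma=(\mathcal{Y},\mathcal{X},L,\mathrm{I},\eta,\epsilon,\mathcal{E})$ consists of a category $\mathcal{Y}$, a class $\mathcal{E}$ of regular epimorphisms of $\mathcal{Y}$ (the extensions), and a full replete subcategory $\mathrm{I}\colon\mathcal{X}\to\mathcal{Y}$ with left adjoint $L$, unit $\eta$ with every component in $\mathcal{E}$, and counit $\epsilon$, such that: $\mathcal{E}$ contains all isomorphisms and is closed under composition; $L$ sends extensions to extensions; pullbacks along extensions exist and a pullback of an extension is an extension; every extension $e\colon Q\to B$ is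 of effective $\mathcal{E}$-descent, i.e. the pullback functor $e^*\colon\mathsf{Ext}(B)\to\mathsf{Ext}(Q)$ is monadic, where $\mathsf{Ext}(B)$ is the full subcategory of the slice over $B$ on the extensions. $\mathcal{X}$ is strongly $\mathcal{E}$-Birkhoff in $\mathcal{Y}$ if for every extension $f\colon A\to B$ the reflection square $(\eta_A,\eta_B)\colon f\to \mathrm{I}L(f)$ is an $\mathcal{E}$-double extension. A trivial $\Gamma$-covering is an extension whose reflection square is a pullback. A $\Gamma$-covering is an extension $c\colon A\to B$ for which there is an extension $e\colon Q\to B$ such that the pullback of $c$ along $e$ is a trivial $\Gamma$-covering. *)

theory Defs
  imports Main
begin

section \<open>Categories and functors\<close>

text \<open>A category is given by carrier sets of objects and morphisms; the operations are total
  functions that are only meaningful on the carriers. \<open>g \<cdot> f\<close> is ``\<open>g\<close> after \<open>f\<close>''.\<close>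

record ('o, 'm) cat =
  Obj :: "'o set"
  Mor :: "'m set"
  Dom :: "'m \<Rightarrow> 'o"
  Cod :: "'m \<Rightarrow> 'o"
  Ident :: "'o \<Rightarrow> 'm"
  Cmp :: "'m \<Rightarrow> 'm \<Rightarrow> 'm" (infixl \<open>\<cdot>\<index>\<close> 70)

definition Hom :: "('o, 'm) cat \<Rightarrow> 'o \<Rightarrow> 'o \<Rightarrow> 'm set" where
  "Hom C A B = {f \<in> Mor C. Dom C f = A \<and> Cod C f = B}"

locale category =
  fixes C :: "('o, 'm) cat" (structure)
  assumes Dom_in: "f \<in> Mor C \<Longrightarrow> Dom C f \<in> Obj C"
    and Cod_in: "f \<in> Mor C \<Longrightarrow> Cod C f \<in> Obj C"
    and Ident_in: "A \<in> Obj C \<Longrightarrow> Ident C A \<in> Hom C A A"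
    and Cmp_in: "\<lbrakk>f \<in> Mor C; g \<in> Mor C; Cod C f = Dom C g\<rbrakk>
      \<Longrightarrow> g \<cdot> f \<in> Hom C (Dom C f) (Cod C g)"
    and Cmp_Ident_right: "f \<in> Mor C \<Longrightarrow> f \<cdot> Ident C (Dom C f) = f"
    and Cmp_Ident_left: "f \<in> Mor C \<Longrightarrow> Ident C (Cod C f) \<cdot> f = f"
    and Cmp_assoc: "\<lbrakk>f \<in> Mor C; g \<in> Mor C; h \<in> Mor C; Cod C f = Dom C g; Cod C g = Dom C h\<rbrakk>
      \<Longrightarrow> (h \<cdot> g) \<cdot> f = h \<cdot> (g \<cdot> f)"

definition isomorphism :: "('o, 'm) cat \<Rightarrow> 'm \<Rightarrow> bool" where
  "isomorphism C f \<longleftrightarrow> f \<in> Mor C \<and>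
     (\<exists>g \<in> Hom C (Cod C f) (Dom C f).
        g \<cdot>\<^bsub>C\<^esub> f = Ident C (Dom C f) \<and> f \<cdot>\<^bsub>C\<^esub> g = Ident C (Cod C f))"

definition regular_epi :: "('o, 'm) cat \<Rightarrow> 'm \<Rightarrow> bool" where
  "regular_epi C f \<longleftrightarrow> f \<in> Mor C \<and>
     (\<exists>u v. u \<in> Mor C \<and> v \<in> Mor C \<and> Dom C u = Dom C v \<and>
        Cod C u = Dom C f \<and> Cod C v = Dom C f \<and> f \<cdot>\<^bsub>C\<^esub> u = f \<cdot>\<^bsub>C\<^esub> v \<and>
        (\<forall>h \<in> Mor C. Dom C h = Dom C f \<and> h \<cdot>\<^bsub>C\<^esub> u = h \<cdot>\<^bsub>C\<^esub> v \<longrightarrow>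
           (\<exists>!k. k \<in> Hom C (Cod C f) (Cod C h) \<and> k \<cdot>\<^bsub>C\<^esub> f = h)))"

text \<open>\<open>pullback C f g p q\<close>: the square with \<open>f \<cdot> p = g \<cdot> q\<close> is a pullback, so \<open>p\<close> is the pullback
  of \<open>g\<close> along \<open>f\<close>.\<close>

definition pullback :: "('o, 'm) cat \<Rightarrow> 'm \<Rightarrow> 'm \<Rightarrow> 'm \<Rightarrow> 'm \<Rightarrow> bool" where
  "pullback C f g p q \<longleftrightarrow>
     f \<in> Mor C \<and> g \<in> Mor C \<and> p \<in> Mor C \<and> q \<in> Mor C \<and>
     Cod C f = Cod C g \<and> Dom C p = Dom C q \<and> Cod C p = Dom C f \<and> Cod C q = Dom C g \<and>
     f \<cdot>\<^bsub>C\<^esub> p = g \<cdot>\<^bsub>C\<^esub> q \<and>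
     (\<forall>u \<in> Mor C. \<forall>v \<in> Mor C.
        Dom C u = Dom C v \<and> Cod C u = Dom C f \<and> Cod C v = Dom C g \<and> f \<cdot>\<^bsub>C\<^esub> u = g \<cdot>\<^bsub>C\<^esub> v \<longrightarrow>
        (\<exists>!k. k \<in> Hom C (Dom C u) (Dom C p) \<and> p \<cdot>\<^bsub>C\<^esub> k = u \<and> q \<cdot>\<^bsub>C\<^esub> k = v))"

record ('o, 'm, 'p, 'n) ftor =
  FObj :: "'o \<Rightarrow> 'p"
  FMor :: "'m \<Rightarrow> 'n"

definition id_ftor :: "('o, 'm, 'o, 'm) ftor" where
  "id_ftor = \<lparr>FObj = (\<lambda>A. A), FMor = (\<lambda>f. f)\<rparr>"

definition comp_ftor :: "('p, 'n, 'q, 'l) ftor \<Rightarrow> ('o, 'm, 'p, 'n) ftor \<Rightarrow> ('o, 'm, 'q, 'l) ftor"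
    (infixr \<open>\<circ>F\<close> 55) where
  "G \<circ>F F = \<lparr>FObj = (\<lambda>A. FObj G (FObj F A)), FMor = (\<lambda>f. FMor G (FMor F f))\<rparr>"

locale cfunctor = source: category C + target: category D
  for C :: "('o, 'm) cat" and D :: "('p, 'n) cat" +
  fixes F :: "('o, 'm, 'p, 'n) ftor"
  assumes FObj_in: "A \<in> Obj C \<Longrightarrow> FObj F A \<in> Obj D"
    and FMor_in: "f \<in> Mor C \<Longrightarrow> FMor F f \<in> Hom D (FObj F (Dom C f)) (FObj F (Cod C f))"
    and FMor_Ident: "A \<in> Obj C \<Longrightarrow> FMor F (Ident C A) = Ident D (FObj F A)"
    and FMor_Cmp: "\<lbrakk>f \<in> Mor C; g \<in> Mor C; Cod C f = Dom C g\<rbrakk>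
      \<Longrightarrow> FMor F (g \<cdot>\<^bsub>C\<^esub> f) = FMor F g \<cdot>\<^bsub>D\<^esub> FMor F f"

locale natural_transformation = source_ftor: cfunctor C D F + target_ftor: cfunctor C D G
  for C :: "('o, 'm) cat" and D :: "('p, 'n) cat"
    and F G :: "('o, 'm, 'p, 'n) ftor" +
  fixes \<tau> :: "'o \<Rightarrow> 'n"
  assumes component_in: "A \<in> Obj C \<Longrightarrow> \<tau> A \<in> Hom D (FObj F A) (FObj G A)"
    and naturality: "f \<in> Mor C
      \<Longrightarrow> FMor G f \<cdot>\<^bsub>D\<^esub> \<tau> (Dom C f) = \<tau> (Cod C f) \<cdot>\<^bsub>D\<^esub> FMor F f"

locale natural_isomorphism = natural_transformation +
  assumes component_iso: "A \<in> Obj C \<Longrightarrow> isomorphism D (\<tau> A)"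

locale equivalence = cfunctor C D K
  for C :: "('o, 'm) cat" and D :: "('p, 'n) cat" and K :: "('o, 'm, 'p, 'n) ftor" +
  assumes quasi_inverse: "\<exists>(G :: ('p, 'n, 'o, 'm) ftor) \<sigma> \<tau>.
      natural_isomorphism C C id_ftor (G \<circ>F K) \<sigma> \<and>
      natural_isomorphism D D (K \<circ>F G) id_ftor \<tau>"

text \<open>\<open>F : C \<rightarrow> D\<close> is left adjoint to \<open>U : D \<rightarrow> C\<close>, with unit \<open>\<eta>\<close> and counit \<open>\<epsilon>\<close>.\<close>

locale adjunction =
  left: cfunctor C D F + right: cfunctor D C U +
  unit: natural_transformation C C id_ftor "U \<circ>F F" \<eta> +
  counit: natural_transformation D D "F \<circ>F U" id_ftor \<epsilon>
  for C :: "('o, 'm) cat" and D :: "('p, 'n) cat"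
    and F :: "('o, 'm, 'p, 'n) ftor" and U :: "('p, 'n, 'o, 'm) ftor"
    and \<eta> :: "'o \<Rightarrow> 'm" and \<epsilon> :: "'p \<Rightarrow> 'n" +
  assumes triangle_left: "A \<in> Obj C
      \<Longrightarrow> \<epsilon> (FObj F A) \<cdot>\<^bsub>D\<^esub> FMor F (\<eta> A) = Ident D (FObj F A)"
    and triangle_right: "B \<in> Obj D
      \<Longrightarrow> FMor U (\<epsilon> B) \<cdot>\<^bsub>C\<^esub> \<eta> (FObj U B) = Ident C (FObj U B)"


section \<open>Monadic functors\<close>

text \<open>The Eilenberg--Moore category of a monad \<open>(T, \<eta>, \<mu>)\<close> on \<open>C\<close>. A morphism is a triple of source
  algebra, underlying morphism of \<open>C\<close>, and target algebra.\<close>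

definition em_algebras ::
    "('o, 'm) cat \<Rightarrow> ('o, 'm, 'o, 'm) ftor \<Rightarrow> ('o \<Rightarrow> 'm) \<Rightarrow> ('o \<Rightarrow> 'm) \<Rightarrow> ('o \<times> 'm) set" where
  "em_algebras C T \<eta> \<mu> = {(A, a). A \<in> Obj C \<and> a \<in> Hom C (FObj T A) A \<and>
     a \<cdot>\<^bsub>C\<^esub> \<eta> A = Ident C A \<and> a \<cdot>\<^bsub>C\<^esub> FMor T a = a \<cdot>\<^bsub>C\<^esub> \<mu> A}"

definition em_category ::
    "('o, 'm) cat \<Rightarrow> ('o, 'm, 'o, 'm) ftor \<Rightarrow> ('o \<Rightarrow> 'm) \<Rightarrow> ('o \<Rightarrow> 'm)
     \<Rightarrow> ('o \<times> 'm, ('o \<times> 'm) \<times> 'm \<times> ('o \<times> 'm)) cat" where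
  "em_category C T \<eta> \<mu> = \<lparr>
     Obj = em_algebras C T \<eta> \<mu>,
     Mor = {((A, a), f, (B, b)). (A, a) \<in> em_algebras C T \<eta> \<mu> \<and> (B, b) \<in> em_algebras C T \<eta> \<mu> \<and>
       f \<in> Hom C A B \<and> f \<cdot>\<^bsub>C\<^esub> a = b \<cdot>\<^bsub>C\<^esub> FMor T f},
     Dom = (\<lambda>(x, f, y). x),
     Cod = (\<lambda>(x, f, y). y),
     Ident = (\<lambda>x. (x, Ident C (fst x), x)),
     Cmp = (\<lambda>(y', g, z) (x, f, y). (x, g \<cdot>\<^bsub>C\<^esub> f, z))\<rparr>"

text \<open>For an adjunction with right adjoint \<open>U : D \<rightarrow> C\<close> and counit \<open>\<epsilon>\<close>, the comparison functor
  from \<open>D\<close> to the Eilenberg--Moore category of the induced monad on \<open>C\<close>.\<close>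

definition em_comparison ::
    "('p, 'n) cat \<Rightarrow> ('p, 'n, 'o, 'm) ftor \<Rightarrow> ('p \<Rightarrow> 'n)
     \<Rightarrow> ('p, 'n, 'o \<times> 'm, ('o \<times> 'm) \<times> 'm \<times> ('o \<times> 'm)) ftor" where
  "em_comparison D U \<epsilon> = \<lparr>
     FObj = (\<lambda>B. (FObj U B, FMor U (\<epsilon> B))),
     FMor = (\<lambda>f. ((FObj U (Dom D f), FMor U (\<epsilon> (Dom D f))), FMor U f,
                  (FObj U (Cod D f), FMor U (\<epsilon> (Cod D f)))))\<rparr>"

definition monadic :: "('p, 'n) cat \<Rightarrow> ('o, 'm) cat \<Rightarrow> ('p, 'n, 'o, 'm) ftor \<Rightarrow> bool" where
  "monadic D C U \<longleftrightarrow> (\<exists>(F :: ('o, 'm, 'p, 'n) ftor) \<eta> \<epsilon>.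
     adjunction C D F U \<eta> \<epsilon> \<and>
     equivalence D (em_category C (U \<circ>F F) \<eta> (\<lambda>A. FMor U (\<epsilon> (FObj F A))))
       (em_comparison D U \<epsilon>))"


section \<open>Slices, extensions and effective descent\<close>

definition full_subcategory :: "('o, 'm) cat \<Rightarrow> 'o set \<Rightarrow> ('o, 'm) cat" where
  "full_subcategory C S =
     C\<lparr>Obj := Obj C \<inter> S, Mor := {f \<in> Mor C. Dom C f \<in> S \<and> Cod C f \<in> S}\<rparr>"

text \<open>In the slice over \<open>B\<close> the triple \<open>(f, h, g)\<close> is the morphism \<open>h\<close> from \<open>f\<close> to \<open>g\<close>.\<close>

definition slice :: "('o, 'm) cat \<Rightarrow> 'o \<Rightarrow> ('m, 'm \<times> 'm \<times> 'm) cat" where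
  "slice C B = \<lparr>
     Obj = {f \<in> Mor C. Cod C f = B},
     Mor = {(f, h, g). f \<in> Mor C \<and> Cod C f = B \<and> g \<in> Mor C \<and> Cod C g = B \<and>
       h \<in> Hom C (Dom C f) (Dom C g) \<and> g \<cdot>\<^bsub>C\<^esub> h = f},
     Dom = (\<lambda>(f, h, g). f),
     Cod = (\<lambda>(f, h, g). g),
     Ident = (\<lambda>f. (f, Ident C (Dom C f), f)),
     Cmp = (\<lambda>(g', k, l) (f, h, g). (f, k \<cdot>\<^bsub>C\<^esub> h, l))\<rparr>"

definition Ext :: "('o, 'm) cat \<Rightarrow> 'm set \<Rightarrow> 'o \<Rightarrow> ('m, 'm \<times> 'm \<times> 'm) cat" where
  "Ext Y \<E> B = full_subcategory (slice Y B) \<E>"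

definition chosen_pullback :: "('o, 'm) cat \<Rightarrow> 'm \<Rightarrow> 'm \<Rightarrow> 'm \<times> 'm" where
  "chosen_pullback C f g = (SOME (p, q). pullback C f g p q)"

text \<open>The functor \<open>e\<^sup>*\<close> from \<open>Ext (Cod e)\<close> to \<open>Ext (Dom e)\<close>. Another choice of pullbacks gives a
  naturally isomorphic functor, so monadicity is independent of \<open>chosen_pullback\<close>.\<close>

definition pullback_functor ::
    "('o, 'm) cat \<Rightarrow> 'm \<Rightarrow> ('m, 'm \<times> 'm \<times> 'm, 'm, 'm \<times> 'm \<times> 'm) ftor" where
  "pullback_functor C e = \<lparr>
     FObj = (\<lambda>f. fst (chosen_pullback C e f)),
     FMor = (\<lambda>(f, h, g).
       let (p, q) = chosen_pullback C e f; (p', q') = chosen_pullback C e g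
       in (p, THE k. k \<in> Hom C (Dom C p) (Dom C p') \<and> p' \<cdot>\<^bsub>C\<^esub> k = p \<and> q' \<cdot>\<^bsub>C\<^esub> k = h \<cdot>\<^bsub>C\<^esub> q, p'))\<rparr>"

definition effective_descent :: "('o, 'm) cat \<Rightarrow> 'm set \<Rightarrow> 'm \<Rightarrow> bool" where
  "effective_descent Y \<E> e \<longleftrightarrow>
     monadic (Ext Y \<E> (Cod Y e)) (Ext Y \<E> (Dom Y e)) (pullback_functor Y e)"


section \<open>Double extensions, Galois structures and coverings\<close>

text \<open>The arguments are \<open>\<alpha>\<^sub>\<top>, \<alpha>\<^sub>\<bottom>, f\<^sub>A, f\<^sub>B\<close>; \<open>c\<close> is the comparison map into the pullback
  with projections \<open>p\<close> and \<open>q\<close>.\<close>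

definition double_extension ::
    "('o, 'm) cat \<Rightarrow> 'm set \<Rightarrow> 'm \<Rightarrow> 'm \<Rightarrow> 'm \<Rightarrow> 'm \<Rightarrow> bool" where
  "double_extension Y \<E> a\<^sub>t a\<^sub>b f\<^sub>A f\<^sub>B \<longleftrightarrow>
     a\<^sub>t \<in> Hom Y (Dom Y f\<^sub>A) (Dom Y f\<^sub>B) \<and> a\<^sub>b \<in> Hom Y (Cod Y f\<^sub>A) (Cod Y f\<^sub>B) \<and>
     f\<^sub>A \<in> Mor Y \<and> f\<^sub>B \<in> Mor Y \<and> f\<^sub>B \<cdot>\<^bsub>Y\<^esub> a\<^sub>t = a\<^sub>b \<cdot>\<^bsub>Y\<^esub> f\<^sub>A \<and>
     a\<^sub>t \<in> \<E> \<and> a\<^sub>b \<in> \<E> \<and> f\<^sub>A \<in> \<E> \<and> f\<^sub>B \<in> \<E> \<and>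
     (\<exists>p q c. pullback Y a\<^sub>b f\<^sub>B p q \<and> p \<in> \<E> \<and> q \<in> \<E> \<and>
        c \<in> Hom Y (Dom Y f\<^sub>A) (Dom Y p) \<and> p \<cdot>\<^bsub>Y\<^esub> c = f\<^sub>A \<and> q \<cdot>\<^bsub>Y\<^esub> c = a\<^sub>t \<and> c \<in> \<E>)"

text \<open>As the full subcategory \<open>X\<close> lives on the types of \<open>Y\<close>, the inclusion \<open>I : X \<rightarrow> Y\<close> is
  \<open>id_ftor\<close>, and the underlying morphism of \<open>I L f\<close> is just \<open>FMor L f\<close>.\<close>

locale galois_structure =
  category Y + adjunction Y X L id_ftor \<eta> \<epsilon>
  for Y X :: "('o, 'm) cat" and L :: "('o, 'm, 'o, 'm) ftor"
    and \<eta> \<epsilon> :: "'o \<Rightarrow> 'm" and \<E> :: "'m set" +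
  assumes full: "X = full_subcategory Y (Obj X)"
    and replete: "\<lbrakk>isomorphism Y f; Dom Y f \<in> Obj X\<rbrakk> \<Longrightarrow> Cod Y f \<in> Obj X"
    and ext_regular_epi: "f \<in> \<E> \<Longrightarrow> regular_epi Y f"
    and unit_ext: "A \<in> Obj Y \<Longrightarrow> \<eta> A \<in> \<E>"
    and iso_ext: "isomorphism Y f \<Longrightarrow> f \<in> \<E>"
    and comp_ext: "\<lbrakk>f \<in> \<E>; g \<in> \<E>; Cod Y f = Dom Y g\<rbrakk> \<Longrightarrow> g \<cdot>\<^bsub>Y\<^esub> f \<in> \<E>"
    and reflector_ext: "f \<in> \<E> \<Longrightarrow> FMor L f \<in> \<E>"
    and pullback_exists: "\<lbrakk>f \<in> \<E>; g \<in> Mor Y; Cod Y g = Cod Y f\<rbrakk> \<Longrightarrow> \<exists>p q. pullback Y g f p q"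
    and pullback_ext: "\<lbrakk>f \<in> \<E>; pullback Y g f p q\<rbrakk> \<Longrightarrow> p \<in> \<E>"
    and ext_descent: "e \<in> \<E> \<Longrightarrow> effective_descent Y \<E> e"

definition strongly_Birkhoff ::
    "('o, 'm) cat \<Rightarrow> ('o, 'm, 'o, 'm) ftor \<Rightarrow> ('o \<Rightarrow> 'm) \<Rightarrow> 'm set \<Rightarrow> bool" where
  "strongly_Birkhoff Y L \<eta> \<E> \<longleftrightarrow>
     (\<forall>f \<in> \<E>. double_extension Y \<E> (\<eta> (Dom Y f)) (\<eta> (Cod Y f)) f (FMor L f))"

definition trivial_covering ::
    "('o, 'm) cat \<Rightarrow> ('o, 'm, 'o, 'm) ftor \<Rightarrow> ('o \<Rightarrow> 'm) \<Rightarrow> 'm set \<Rightarrow> 'm \<Rightarrow> bool" where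
  "trivial_covering Y L \<eta> \<E> f \<longleftrightarrow>
     f \<in> \<E> \<and> pullback Y (\<eta> (Cod Y f)) (FMor L f) f (\<eta> (Dom Y f))"

definition covering ::
    "('o, 'm) cat \<Rightarrow> ('o, 'm, 'o, 'm) ftor \<Rightarrow> ('o \<Rightarrow> 'm) \<Rightarrow> 'm set \<Rightarrow> 'm \<Rightarrow> bool" where
  "covering Y L \<eta> \<E> c \<longleftrightarrow>
     c \<in> \<E> \<and> (\<exists>e \<in> \<E>. Cod Y e = Cod Y c \<and>
       (\<exists>p q. pullback Y e c p q \<and> trivial_covering Y L \<eta> \<E> p))"

end

theory Submission
  imports Defs
begin

text \<open>
  Let \<open>f\<^sub>A\<close> be split by the extension \<open>e : Q \<rightarrow> A\<^sub>\<bottom>\<close>. Then \<open>f\<^sub>B\<close> is split by \<open>a\<^sub>b \<cdot> e\<close>. Indeed,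
  the comparison map \<open>A\<^sub>\<top> \<rightarrow> A\<^sub>\<bottom> \<times> B\<^sub>\<top>\<close> of the double extension is a morphism over \<open>A\<^sub>\<bottom>\<close>, and pulling
  it back along \<open>e\<close> gives an extension \<open>c\<close> from \<open>t = e\<^sup>*f\<^sub>A\<close> to \<open>p = (a\<^sub>b \<cdot> e)\<^sup>*f\<^sub>B\<close> over \<open>Q\<close>. So it
  suffices to show: if \<open>t = p \<cdot> c\<close> is a trivial covering and \<open>p\<close>, \<open>c\<close> are extensions, then \<open>p\<close> is a
  trivial covering (\<open>trivial_covering_left_factor\<close>).

  The strong Birkhoff condition makes this a question about monomorphisms. For an extension
  \<open>f : A \<rightarrow> B\<close> the comparison map \<open>A \<rightarrow> B \<times> L A\<close>, the product being taken over \<open>L B\<close>, is an extension,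
  hence a regular epimorphism, hence an isomorphism as soon as it is monic. So \<open>f\<close> is a trivial
  covering if and only if \<open>f\<close> and \<open>\<eta> A\<close> are jointly monic
  (\<open>trivial_covering_iff_jointly_monic\<close>).

  Now \<open>c\<close> is a trivial covering, because what \<open>c\<close> identifies is identified by \<open>t = p \<cdot> c\<close>. For \<open>p\<close>,
  let \<open>u\<close> and \<open>v\<close> be morphisms into the domain \<open>P\<close> of \<open>p\<close> that agree after \<open>p\<close> and after \<open>\<eta> P\<close>.
  Locally, that is after composition with an extension \<open>z\<close>, the common value \<open>\<eta> P \<cdot> u = \<eta> P \<cdot> v\<close>
  lifts along \<open>L c\<close>; as the reflection square of \<open>c\<close> is a pullback, \<open>u \<cdot> z\<close> and \<open>v \<cdot> z\<close> lift along
  \<open>c\<close> to morphisms that agree after \<open>\<eta>\<close> and after \<open>t\<close>. These lifts are therefore equal, and \<open>u = v\<close>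
  because \<open>z\<close> is epic.
\<close>

section \<open>Pullbacks and regular epimorphisms\<close>

text \<open>Taking \<open>p = q\<close> expresses that a single morphism is monic.\<close>

definition jointly_monic :: "('o, 'm) cat \<Rightarrow> 'm \<Rightarrow> 'm \<Rightarrow> bool" where
  "jointly_monic C p q \<longleftrightarrow> (\<forall>u \<in> Mor C. \<forall>v \<in> Mor C.
     Dom C u = Dom C v \<and> Cod C u = Dom C p \<and> Cod C v = Dom C p \<and>
     p \<cdot>\<^bsub>C\<^esub> u = p \<cdot>\<^bsub>C\<^esub> v \<and> q \<cdot>\<^bsub>C\<^esub> u = q \<cdot>\<^bsub>C\<^esub> v \<longrightarrow> u = v)"

lemma pullback_symmetric:
  assumes "pullback C f g p q"
  shows "pullback C g f q p"
  using assms unfolding pullback_def by (simp, metis)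

lemma pullback_factor:
  assumes "pullback C f g p q"
    and "u \<in> Mor C" "v \<in> Mor C" "Dom C u = Dom C v" "Cod C u = Dom C f" "Cod C v = Dom C g"
    and "f \<cdot>\<^bsub>C\<^esub> u = g \<cdot>\<^bsub>C\<^esub> v"
  obtains k where "k \<in> Mor C" "Dom C k = Dom C u" "Cod C k = Dom C p"
    "p \<cdot>\<^bsub>C\<^esub> k = u" "q \<cdot>\<^bsub>C\<^esub> k = v"
  using assms unfolding pullback_def Hom_def by blast

context category
begin

lemma cmp_closed [simp]:
  assumes "f \<in> Mor C" "g \<in> Mor C" "Cod C f = Dom C g"
  shows "g \<cdot> f \<in> Mor C" "Dom C (g \<cdot> f) = Dom C f" "Cod C (g \<cdot> f) = Cod C g"
  using Cmp_in[OF assms] by (auto simp: Hom_def)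

lemma ident_closed [simp]:
  assumes "A \<in> Obj C"
  shows "Ident C A \<in> Mor C" "Dom C (Ident C A) = A" "Cod C (Ident C A) = A"
  using Ident_in[OF assms] by (auto simp: Hom_def)

lemma pullback_jointly_monic:
  assumes pb: "pullback C f g p q"
  shows "jointly_monic C p q"
  unfolding jointly_monic_def
proof (intro ballI impI, elim conjE)
  fix u v
  assume uv: "u \<in> Mor C" "v \<in> Mor C" "Dom C u = Dom C v" "Cod C u = Dom C p" "Cod C v = Dom C p"
    "p \<cdot> u = p \<cdot> v" "q \<cdot> u = q \<cdot> v"
  have sq: "f \<in> Mor C" "g \<in> Mor C" "p \<in> Mor C" "q \<in> Mor C" "Cod C p = Dom C f" "Cod C q = Dom C g"
    "Dom C p = Dom C q" "f \<cdot> p = g \<cdot> q"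
    using pb by (auto simp: pullback_def)
  have "f \<cdot> (p \<cdot> u) = g \<cdot> (q \<cdot> u)"
    using uv sq by (metis Cmp_assoc)
  moreover have "p \<cdot> u \<in> Mor C" "q \<cdot> u \<in> Mor C" "Dom C (p \<cdot> u) = Dom C u" "Dom C (q \<cdot> u) = Dom C u"
    "Cod C (p \<cdot> u) = Dom C f" "Cod C (q \<cdot> u) = Dom C g"
    using uv sq by auto
  ultimately have "\<exists>!k. k \<in> Hom C (Dom C u) (Dom C p) \<and> p \<cdot> k = p \<cdot> u \<and> q \<cdot> k = q \<cdot> u"
    using pb unfolding pullback_def by metis
  moreover have "u \<in> Hom C (Dom C u) (Dom C p)" "v \<in> Hom C (Dom C u) (Dom C p)"
    using uv by (auto simp: Hom_def)
  ultimately show "u = v" using uv by metis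
qed

lemma pullbackI:
  assumes "f \<in> Mor C" "g \<in> Mor C" "p \<in> Mor C" "q \<in> Mor C" "Cod C f = Cod C g"
    and "Dom C p = Dom C q" "Cod C p = Dom C f" "Cod C q = Dom C g" "f \<cdot> p = g \<cdot> q"
    and "jointly_monic C p q"
    and factor: "\<And>u v. \<lbrakk>u \<in> Mor C; v \<in> Mor C; Dom C u = Dom C v; Cod C u = Dom C f;
      Cod C v = Dom C g; f \<cdot> u = g \<cdot> v\<rbrakk>
      \<Longrightarrow> \<exists>k \<in> Mor C. Dom C k = Dom C u \<and> Cod C k = Dom C p \<and> p \<cdot> k = u \<and> q \<cdot> k = v"
  shows "pullback C f g p q"
proof -
  have "\<exists>!k. k \<in> Hom C (Dom C u) (Dom C p) \<and> p \<cdot> k = u \<and> q \<cdot> k = v"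
    if uv: "u \<in> Mor C" "v \<in> Mor C" "Dom C u = Dom C v" "Cod C u = Dom C f" "Cod C v = Dom C g"
      "f \<cdot> u = g \<cdot> v" for u v
  proof -
    obtain k where k: "k \<in> Mor C" "Dom C k = Dom C u" "Cod C k = Dom C p" "p \<cdot> k = u" "q \<cdot> k = v"
      using factor[OF uv] by blast
    have unique: "k' = k"
      if "k' \<in> Hom C (Dom C u) (Dom C p) \<and> p \<cdot> k' = u \<and> q \<cdot> k' = v" for k'
    proof (rule \<open>jointly_monic C p q\<close>[unfolded jointly_monic_def, rule_format])
      show "Dom C k' = Dom C k \<and> Cod C k' = Dom C p \<and> Cod C k = Dom C p \<and>
          p \<cdot> k' = p \<cdot> k \<and> q \<cdot> k' = q \<cdot> k"
        using that k by (simp add: Hom_def)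
    qed (use that k in \<open>simp_all add: Hom_def\<close>)
    show ?thesis by (rule ex1I[OF _ unique]) (use k in \<open>simp_all add: Hom_def\<close>)
  qed
  then show ?thesis using assms(1-9) by (simp add: pullback_def)
qed

lemma pullback_cancel:
  assumes inner: "pullback C f g p q" and outer: "pullback C (f \<cdot> h) g p' q'"
    and h: "h \<in> Mor C" "Cod C h = Dom C f"
    and m: "m \<in> Mor C" "Dom C m = Dom C p'" "Cod C m = Dom C p" "p \<cdot> m = h \<cdot> p'" "q \<cdot> m = q'"
  shows "pullback C h p p' m"
proof -
  have sq: "f \<in> Mor C" "g \<in> Mor C" "p \<in> Mor C" "q \<in> Mor C" "Cod C p = Dom C f" "Cod C q = Dom C g"
    "Dom C p = Dom C q" "f \<cdot> p = g \<cdot> q"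
    using inner by (auto simp: pullback_def)
  have sq': "p' \<in> Mor C" "Cod C p' = Dom C h"
    using outer h sq by (auto simp: pullback_def)
  show ?thesis
  proof (rule pullbackI)
    show "jointly_monic C p' m"
      unfolding jointly_monic_def
    proof (intro ballI impI, elim conjE)
      fix u v
      assume uv: "u \<in> Mor C" "v \<in> Mor C" "Dom C u = Dom C v" "Cod C u = Dom C p'"
        "Cod C v = Dom C p'" "p' \<cdot> u = p' \<cdot> v" "m \<cdot> u = m \<cdot> v"
      have "q' \<cdot> u = q \<cdot> (m \<cdot> u)" "q' \<cdot> v = q \<cdot> (m \<cdot> v)"
        using uv sq m Cmp_assoc[of u m q] Cmp_assoc[of v m q] by auto
      then show "u = v"
        using pullback_jointly_monic[OF outer] uv unfolding jointly_monic_def by metis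
    qed
  next
    fix u v
    assume uv: "u \<in> Mor C" "v \<in> Mor C" "Dom C u = Dom C v" "Cod C u = Dom C h" "Cod C v = Dom C p"
      "h \<cdot> u = p \<cdot> v"
    have "(f \<cdot> h) \<cdot> u = f \<cdot> (p \<cdot> v)" using uv sq h Cmp_assoc[of u h f] by simp
    also have "\<dots> = g \<cdot> (q \<cdot> v)" using uv sq by (metis Cmp_assoc)
    finally obtain k where k: "k \<in> Mor C" "Dom C k = Dom C u" "Cod C k = Dom C p'" "p' \<cdot> k = u"
        "q' \<cdot> k = q \<cdot> v"
      using pullback_factor[OF outer, of u "q \<cdot> v"] uv sq h by auto
    have "p \<cdot> (m \<cdot> k) = (h \<cdot> p') \<cdot> k" using k m sq Cmp_assoc[of k m p] by simp
    also have "\<dots> = p \<cdot> v" using k sq' h uv Cmp_assoc[of k p' h] by simp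
    finally have "p \<cdot> (m \<cdot> k) = p \<cdot> v" .
    moreover have "q \<cdot> (m \<cdot> k) = q \<cdot> v" using k m sq Cmp_assoc[of k m q] by simp
    ultimately have "m \<cdot> k = v"
      using pullback_jointly_monic[OF inner] k m uv unfolding jointly_monic_def by simp
    then show "\<exists>k \<in> Mor C. Dom C k = Dom C u \<and> Cod C k = Dom C p' \<and> p' \<cdot> k = u \<and> m \<cdot> k = v"
      using k by blast
  qed (use sq sq' h m in auto)
qed

lemma pullback_precomp_iso:
  assumes pb: "pullback C f g p q" and iso: "isomorphism C c" and c: "Cod C c = Dom C p"
  shows "pullback C f g (p \<cdot> c) (q \<cdot> c)"
proof -
  have sq: "f \<in> Mor C" "g \<in> Mor C" "p \<in> Mor C" "q \<in> Mor C" "Cod C p = Dom C f" "Cod C q = Dom C g"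
    "Dom C p = Dom C q" "f \<cdot> p = g \<cdot> q" "Cod C f = Cod C g"
    using pb by (auto simp: pullback_def)
  obtain d where d: "c \<in> Mor C" "d \<in> Mor C" "Dom C d = Cod C c" "Cod C d = Dom C c"
      "d \<cdot> c = Ident C (Dom C c)" "c \<cdot> d = Ident C (Cod C c)"
    using iso by (auto simp: isomorphism_def Hom_def)
  show ?thesis
  proof (rule pullbackI)
    show "f \<cdot> (p \<cdot> c) = g \<cdot> (q \<cdot> c)"
      using sq c d by (metis Cmp_assoc)
    show "jointly_monic C (p \<cdot> c) (q \<cdot> c)"
      unfolding jointly_monic_def
    proof (intro ballI impI, elim conjE)
      fix u v
      assume uv: "u \<in> Mor C" "v \<in> Mor C" "Dom C u = Dom C v" "Cod C u = Dom C (p \<cdot> c)"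
        "Cod C v = Dom C (p \<cdot> c)" "(p \<cdot> c) \<cdot> u = (p \<cdot> c) \<cdot> v" "(q \<cdot> c) \<cdot> u = (q \<cdot> c) \<cdot> v"
      then have cod: "Cod C u = Dom C c" "Cod C v = Dom C c" using sq c d by auto
      have "p \<cdot> (c \<cdot> u) = p \<cdot> (c \<cdot> v)" "q \<cdot> (c \<cdot> u) = q \<cdot> (c \<cdot> v)"
        using uv cod sq c d by (simp_all add: Cmp_assoc)
      then have "c \<cdot> u = c \<cdot> v"
        using pullback_jointly_monic[OF pb] uv cod c d unfolding jointly_monic_def by simp
      moreover have "(d \<cdot> c) \<cdot> u = d \<cdot> (c \<cdot> u)" "(d \<cdot> c) \<cdot> v = d \<cdot> (c \<cdot> v)"
        by (rule Cmp_assoc; use uv cod d in simp)+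
      ultimately have "(d \<cdot> c) \<cdot> u = (d \<cdot> c) \<cdot> v" by simp
      then show "u = v" using uv cod d by (metis Cmp_Ident_left)
    qed
  next
    fix u v
    assume uv: "u \<in> Mor C" "v \<in> Mor C" "Dom C u = Dom C v" "Cod C u = Dom C f" "Cod C v = Dom C g"
      "f \<cdot> u = g \<cdot> v"
    obtain k where k: "k \<in> Mor C" "Dom C k = Dom C u" "Cod C k = Dom C p" "p \<cdot> k = u" "q \<cdot> k = v"
      using pullback_factor[OF pb uv] by blast
    have "c \<cdot> (d \<cdot> k) = k"
      using k c d by (metis Cmp_assoc Cmp_Ident_left)
    then have "(p \<cdot> c) \<cdot> (d \<cdot> k) = u" "(q \<cdot> c) \<cdot> (d \<cdot> k) = v"
      using k c d sq by (simp_all add: Cmp_assoc)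
    then show "\<exists>k \<in> Mor C. Dom C k = Dom C u \<and> Cod C k = Dom C (p \<cdot> c) \<and>
        (p \<cdot> c) \<cdot> k = u \<and> (q \<cdot> c) \<cdot> k = v"
      using k c d sq by (intro bexI[of _ "d \<cdot> k"]) auto
  qed (use sq c d in auto)
qed

lemma regular_epi_epic:
  assumes "regular_epi C f" "a \<in> Mor C" "b \<in> Mor C" "Dom C a = Cod C f" "Dom C b = Cod C f"
    and cod: "Cod C a = Cod C b" and eq: "a \<cdot> f = b \<cdot> f"
  shows "a = b"
proof -
  obtain u v where f: "f \<in> Mor C" and uv: "u \<in> Mor C" "v \<in> Mor C" "Cod C u = Dom C f"
      "Cod C v = Dom C f" "f \<cdot> u = f \<cdot> v"
    and coeq: "\<forall>h \<in> Mor C. Dom C h = Dom C f \<and> h \<cdot> u = h \<cdot> v \<longrightarrow>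
      (\<exists>!k. k \<in> Hom C (Cod C f) (Cod C h) \<and> k \<cdot> f = h)"
    using assms(1) unfolding regular_epi_def by blast
  have "(a \<cdot> f) \<cdot> u = (a \<cdot> f) \<cdot> v"
    using assms(2,4) f uv by (simp add: Cmp_assoc)
  then have "\<exists>!k. k \<in> Hom C (Cod C f) (Cod C (a \<cdot> f)) \<and> k \<cdot> f = a \<cdot> f"
    by (intro coeq[rule_format] conjI) (use assms(2,4) f in auto)
  moreover have "a \<in> Hom C (Cod C f) (Cod C (a \<cdot> f))" "b \<in> Hom C (Cod C f) (Cod C (a \<cdot> f))"
    using assms f by (auto simp: Hom_def)
  ultimately show ?thesis using eq by metis
qed

lemma regular_epi_monic_iso:
  assumes epi: "regular_epi C f" and mono: "jointly_monic C f f"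
  shows "isomorphism C f"
proof -
  obtain u v where f: "f \<in> Mor C" and uv: "u \<in> Mor C" "v \<in> Mor C" "Dom C u = Dom C v"
      "Cod C u = Dom C f" "Cod C v = Dom C f" "f \<cdot> u = f \<cdot> v"
    and coeq: "\<forall>h \<in> Mor C. Dom C h = Dom C f \<and> h \<cdot> u = h \<cdot> v \<longrightarrow>
      (\<exists>!k. k \<in> Hom C (Cod C f) (Cod C h) \<and> k \<cdot> f = h)"
    using epi unfolding regular_epi_def by blast
  \<comment> \<open>As \<open>f\<close> is monic, the pair that it coequalizes is trivial, so the identity factors through \<open>f\<close>.\<close>
  have "u = v" using mono uv unfolding jointly_monic_def by blast
  moreover have obj: "Dom C f \<in> Obj C" "Cod C f \<in> Obj C" using f Dom_in Cod_in by auto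
  ultimately obtain k where k: "k \<in> Mor C" "Dom C k = Cod C f" "Cod C k = Dom C f"
      "k \<cdot> f = Ident C (Dom C f)"
    using bspec[OF coeq, of "Ident C (Dom C f)"] by (auto simp: Hom_def)
  have "(f \<cdot> k) \<cdot> f = f" using f k by (simp add: Cmp_assoc Cmp_Ident_right)
  then have "(f \<cdot> k) \<cdot> f = Ident C (Cod C f) \<cdot> f" using f by (simp add: Cmp_Ident_left)
  then have "f \<cdot> k = Ident C (Cod C f)"
    using regular_epi_epic[OF epi] f k obj by simp
  then show ?thesis using f k by (auto simp: isomorphism_def Hom_def)
qed

end

section \<open>Trivial coverings\<close>

context galois_structure
begin

lemma ext_mor:
  assumes "f \<in> \<E>"
  shows "f \<in> Mor Y"
  using ext_regular_epi[OF assms] by (simp add: regular_epi_def)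

text \<open>The reflection square of \<open>f\<close> is a pullback when its comparison map is an isomorphism. The
  strong Birkhoff condition makes that map a regular epimorphism; joint monicity makes it monic.\<close>

lemma trivial_covering_iff_jointly_monic:
  assumes sB: "strongly_Birkhoff Y L \<eta> \<E>" and f: "f \<in> \<E>"
  shows "trivial_covering Y L \<eta> \<E> f \<longleftrightarrow> jointly_monic Y f (\<eta> (Dom Y f))"
proof
  assume "trivial_covering Y L \<eta> \<E> f"
  then show "jointly_monic Y f (\<eta> (Dom Y f))"
    using pullback_jointly_monic by (auto simp: trivial_covering_def)
next
  assume jm: "jointly_monic Y f (\<eta> (Dom Y f))"
  have "double_extension Y \<E> (\<eta> (Dom Y f)) (\<eta> (Cod Y f)) f (FMor L f)"
    using sB f by (auto simp: strongly_Birkhoff_def)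
  then obtain p q c where pb: "pullback Y (\<eta> (Cod Y f)) (FMor L f) p q"
    and c: "c \<in> Mor Y" "Dom Y c = Dom Y f" "Cod Y c = Dom Y p"
      "p \<cdot>\<^bsub>Y\<^esub> c = f" "q \<cdot>\<^bsub>Y\<^esub> c = \<eta> (Dom Y f)" "c \<in> \<E>"
    unfolding double_extension_def Hom_def by auto
  have pq: "p \<in> Mor Y" "q \<in> Mor Y" "Dom Y p = Dom Y q" using pb by (auto simp: pullback_def)
  have "jointly_monic Y c c"
    unfolding jointly_monic_def
  proof (intro ballI impI, elim conjE)
    fix u v
    assume uv: "u \<in> Mor Y" "v \<in> Mor Y" "Dom Y u = Dom Y v" "Cod Y u = Dom Y c" "Cod Y v = Dom Y c"
      "c \<cdot>\<^bsub>Y\<^esub> u = c \<cdot>\<^bsub>Y\<^esub> v"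
    have "(p \<cdot>\<^bsub>Y\<^esub> c) \<cdot>\<^bsub>Y\<^esub> u = (p \<cdot>\<^bsub>Y\<^esub> c) \<cdot>\<^bsub>Y\<^esub> v" "(q \<cdot>\<^bsub>Y\<^esub> c) \<cdot>\<^bsub>Y\<^esub> u = (q \<cdot>\<^bsub>Y\<^esub> c) \<cdot>\<^bsub>Y\<^esub> v"
      using uv c(1-3) pq by (simp_all add: Cmp_assoc)
    then show "u = v"
      using jm uv c unfolding jointly_monic_def by simp
  qed
  then have "isomorphism Y c"
    using regular_epi_monic_iso ext_regular_epi c by blast
  then have "pullback Y (\<eta> (Cod Y f)) (FMor L f) (p \<cdot>\<^bsub>Y\<^esub> c) (q \<cdot>\<^bsub>Y\<^esub> c)"
    using pullback_precomp_iso pb c by blast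
  then show "trivial_covering Y L \<eta> \<E> f"
    using c f by (simp add: trivial_covering_def)
qed

lemma trivial_covering_right_factor:
  assumes sB: "strongly_Birkhoff Y L \<eta> \<E>"
    and c: "c \<in> \<E>" and p: "p \<in> \<E>" and cp: "Cod Y c = Dom Y p"
    and triv: "trivial_covering Y L \<eta> \<E> (p \<cdot>\<^bsub>Y\<^esub> c)"
  shows "trivial_covering Y L \<eta> \<E> c"
proof -
  have mor: "c \<in> Mor Y" "p \<in> Mor Y" using c p ext_mor by auto
  have jm: "jointly_monic Y (p \<cdot>\<^bsub>Y\<^esub> c) (\<eta> (Dom Y c))"
    using triv trivial_covering_iff_jointly_monic[OF sB, of "p \<cdot>\<^bsub>Y\<^esub> c"] comp_ext[OF c p cp] mor cp
    by simp
  have "jointly_monic Y c (\<eta> (Dom Y c))"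
    unfolding jointly_monic_def
  proof (intro ballI impI, elim conjE)
    fix u v
    assume uv: "u \<in> Mor Y" "v \<in> Mor Y" "Dom Y u = Dom Y v" "Cod Y u = Dom Y c" "Cod Y v = Dom Y c"
      "c \<cdot>\<^bsub>Y\<^esub> u = c \<cdot>\<^bsub>Y\<^esub> v" "\<eta> (Dom Y c) \<cdot>\<^bsub>Y\<^esub> u = \<eta> (Dom Y c) \<cdot>\<^bsub>Y\<^esub> v"
    have "(p \<cdot>\<^bsub>Y\<^esub> c) \<cdot>\<^bsub>Y\<^esub> u = (p \<cdot>\<^bsub>Y\<^esub> c) \<cdot>\<^bsub>Y\<^esub> v"
      using uv mor cp by (simp add: Cmp_assoc)
    then show "u = v" using jm uv mor cp unfolding jointly_monic_def by simp
  qed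
  then show ?thesis using trivial_covering_iff_jointly_monic[OF sB c] by simp
qed

text \<open>Joint monicity of \<open>p\<close> and its unit may be tested after composition with an extension, so the
  morphisms to be compared may be assumed to lift along \<open>c\<close>, to lifts that agree after the unit.\<close>

lemma trivial_covering_left_factor:
  assumes sB: "strongly_Birkhoff Y L \<eta> \<E>"
    and c: "c \<in> \<E>" and p: "p \<in> \<E>" and cp: "Cod Y c = Dom Y p"
    and triv: "trivial_covering Y L \<eta> \<E> (p \<cdot>\<^bsub>Y\<^esub> c)"
  shows "trivial_covering Y L \<eta> \<E> p"
proof -
  have mor: "c \<in> Mor Y" "p \<in> Mor Y" using c p ext_mor by auto
  have jm: "jointly_monic Y (p \<cdot>\<^bsub>Y\<^esub> c) (\<eta> (Dom Y c))"
    using triv trivial_covering_iff_jointly_monic[OF sB, of "p \<cdot>\<^bsub>Y\<^esub> c"] comp_ext[OF c p cp] mor cp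
    by simp
  have pb: "pullback Y (\<eta> (Dom Y p)) (FMor L c) c (\<eta> (Dom Y c))"
    using trivial_covering_right_factor[OF assms] cp by (simp add: trivial_covering_def)
  then have sq: "\<eta> (Dom Y p) \<in> Mor Y" "FMor L c \<in> Mor Y" "Cod Y (\<eta> (Dom Y p)) = Cod Y (FMor L c)"
    "Dom Y (\<eta> (Dom Y p)) = Dom Y p"
    using cp by (auto simp: pullback_def)
  have "jointly_monic Y p (\<eta> (Dom Y p))"
    unfolding jointly_monic_def
  proof (intro ballI impI, elim conjE)
    fix u v
    assume uv: "u \<in> Mor Y" "v \<in> Mor Y" "Dom Y u = Dom Y v" "Cod Y u = Dom Y p" "Cod Y v = Dom Y p"
      "p \<cdot>\<^bsub>Y\<^esub> u = p \<cdot>\<^bsub>Y\<^esub> v" "\<eta> (Dom Y p) \<cdot>\<^bsub>Y\<^esub> u = \<eta> (Dom Y p) \<cdot>\<^bsub>Y\<^esub> v"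
    obtain z w where zw: "pullback Y (\<eta> (Dom Y p) \<cdot>\<^bsub>Y\<^esub> u) (FMor L c) z w"
      using pullback_exists[OF reflector_ext[OF c], of "\<eta> (Dom Y p) \<cdot>\<^bsub>Y\<^esub> u"] uv sq by auto
    have z: "z \<in> \<E>" using pullback_ext[OF reflector_ext[OF c] zw] .
    have zw': "z \<in> Mor Y" "w \<in> Mor Y" "Dom Y z = Dom Y w" "Cod Y z = Dom Y u"
      "Cod Y w = Dom Y (FMor L c)" "(\<eta> (Dom Y p) \<cdot>\<^bsub>Y\<^esub> u) \<cdot>\<^bsub>Y\<^esub> z = FMor L c \<cdot>\<^bsub>Y\<^esub> w"
      using zw uv sq by (auto simp: pullback_def)
    have lift: "\<exists>x' \<in> Mor Y. Dom Y x' = Dom Y z \<and> Cod Y x' = Dom Y c \<and>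
        c \<cdot>\<^bsub>Y\<^esub> x' = x \<cdot>\<^bsub>Y\<^esub> z \<and> \<eta> (Dom Y c) \<cdot>\<^bsub>Y\<^esub> x' = w"
      if x: "x \<in> Mor Y" "Dom Y x = Dom Y u" "Cod Y x = Dom Y p"
        "\<eta> (Dom Y p) \<cdot>\<^bsub>Y\<^esub> x = \<eta> (Dom Y p) \<cdot>\<^bsub>Y\<^esub> u" for x
    proof -
      have "\<eta> (Dom Y p) \<cdot>\<^bsub>Y\<^esub> (x \<cdot>\<^bsub>Y\<^esub> z) = FMor L c \<cdot>\<^bsub>Y\<^esub> w"
        using x zw' sq Cmp_assoc[of z x "\<eta> (Dom Y p)"] by simp
      then show ?thesis
        using pullback_factor[OF pb, of "x \<cdot>\<^bsub>Y\<^esub> z" w] x zw' sq by auto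
    qed
    obtain u' where u': "u' \<in> Mor Y" "Dom Y u' = Dom Y z" "Cod Y u' = Dom Y c"
        "c \<cdot>\<^bsub>Y\<^esub> u' = u \<cdot>\<^bsub>Y\<^esub> z" "\<eta> (Dom Y c) \<cdot>\<^bsub>Y\<^esub> u' = w"
      using lift[of u] uv by auto
    obtain v' where v': "v' \<in> Mor Y" "Dom Y v' = Dom Y z" "Cod Y v' = Dom Y c"
        "c \<cdot>\<^bsub>Y\<^esub> v' = v \<cdot>\<^bsub>Y\<^esub> z" "\<eta> (Dom Y c) \<cdot>\<^bsub>Y\<^esub> v' = w"
      using lift[of v] uv by auto
    have "p \<cdot>\<^bsub>Y\<^esub> (u \<cdot>\<^bsub>Y\<^esub> z) = p \<cdot>\<^bsub>Y\<^esub> (v \<cdot>\<^bsub>Y\<^esub> z)"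
      using uv zw' mor Cmp_assoc[of z u p] Cmp_assoc[of z v p] by simp
    then have "(p \<cdot>\<^bsub>Y\<^esub> c) \<cdot>\<^bsub>Y\<^esub> u' = (p \<cdot>\<^bsub>Y\<^esub> c) \<cdot>\<^bsub>Y\<^esub> v'"
      using u' v' mor cp by (simp add: Cmp_assoc)
    then have "u' = v'"
      using jm u' v' mor cp unfolding jointly_monic_def by simp
    then have "u \<cdot>\<^bsub>Y\<^esub> z = v \<cdot>\<^bsub>Y\<^esub> z" using u' v' by simp
    then show "u = v"
      using regular_epi_epic[OF ext_regular_epi[OF z]] uv zw' by simp
  qed
  then show ?thesis using trivial_covering_iff_jointly_monic[OF sB p] by simp
qed

section \<open>Coverings\<close>

text \<open>The pasting argument: the pullback of \<open>f\<^sub>B\<close> along \<open>a\<^sub>b \<cdot> e\<close> is also the pullback along \<open>e\<close> of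
  the projection \<open>p\<close>, through which \<open>f\<^sub>A\<close> factors by an extension.\<close>

lemma covering_double_extension_quotient:
  assumes sB: "strongly_Birkhoff Y L \<eta> \<E>"
    and dbl: "double_extension Y \<E> a\<^sub>t a\<^sub>b f\<^sub>A f\<^sub>B"
    and cov: "covering Y L \<eta> \<E> f\<^sub>A"
  shows "covering Y L \<eta> \<E> f\<^sub>B"
proof -
  obtain e t s where e: "e \<in> \<E>" "Cod Y e = Cod Y f\<^sub>A" and ts: "pullback Y e f\<^sub>A t s"
    and triv: "trivial_covering Y L \<eta> \<E> t"
    using cov by (auto simp: covering_def)
  obtain p q c where ab: "a\<^sub>b \<in> \<E>" "a\<^sub>b \<in> Mor Y" "Dom Y a\<^sub>b = Cod Y f\<^sub>A" "Cod Y a\<^sub>b = Cod Y f\<^sub>B"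
    and fB: "f\<^sub>B \<in> \<E>" and pq: "pullback Y a\<^sub>b f\<^sub>B p q"
    and c: "c \<in> Mor Y" "Dom Y c = Dom Y f\<^sub>A" "Cod Y c = Dom Y p" "p \<cdot>\<^bsub>Y\<^esub> c = f\<^sub>A" "c \<in> \<E>"
    using dbl unfolding double_extension_def Hom_def by auto
  have eM: "e \<in> Mor Y" using e ext_mor by auto
  have p: "p \<in> Mor Y" "Cod Y p = Dom Y a\<^sub>b" "q \<in> Mor Y" "Cod Y q = Dom Y f\<^sub>B" "Dom Y p = Dom Y q"
    "a\<^sub>b \<cdot>\<^bsub>Y\<^esub> p = f\<^sub>B \<cdot>\<^bsub>Y\<^esub> q"
    using pq by (auto simp: pullback_def)
  have ts': "t \<in> Mor Y" "s \<in> Mor Y" "Dom Y t = Dom Y s" "Cod Y t = Dom Y e" "Cod Y s = Dom Y f\<^sub>A"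
    "e \<cdot>\<^bsub>Y\<^esub> t = f\<^sub>A \<cdot>\<^bsub>Y\<^esub> s"
    using ts by (auto simp: pullback_def)
  have abe: "a\<^sub>b \<cdot>\<^bsub>Y\<^esub> e \<in> \<E>" "Cod Y (a\<^sub>b \<cdot>\<^bsub>Y\<^esub> e) = Cod Y f\<^sub>B"
    using e eM ab comp_ext by auto
  obtain p' q' where p'q': "pullback Y (a\<^sub>b \<cdot>\<^bsub>Y\<^esub> e) f\<^sub>B p' q'"
    using pullback_exists[OF fB, of "a\<^sub>b \<cdot>\<^bsub>Y\<^esub> e"] abe ext_mor by blast
  have p'E: "p' \<in> \<E>" using pullback_ext[OF fB p'q'] .
  have p': "p' \<in> Mor Y" "q' \<in> Mor Y" "Cod Y p' = Dom Y e" "Cod Y q' = Dom Y f\<^sub>B"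
      "Dom Y p' = Dom Y q'" "(a\<^sub>b \<cdot>\<^bsub>Y\<^esub> e) \<cdot>\<^bsub>Y\<^esub> p' = f\<^sub>B \<cdot>\<^bsub>Y\<^esub> q'"
    using p'q' eM ab e by (auto simp: pullback_def)
  have "a\<^sub>b \<cdot>\<^bsub>Y\<^esub> (e \<cdot>\<^bsub>Y\<^esub> p') = f\<^sub>B \<cdot>\<^bsub>Y\<^esub> q'"
    using p' eM ab e Cmp_assoc[of p' e a\<^sub>b] by simp
  then obtain m where m: "m \<in> Mor Y" "Dom Y m = Dom Y p'" "Cod Y m = Dom Y p"
      "p \<cdot>\<^bsub>Y\<^esub> m = e \<cdot>\<^bsub>Y\<^esub> p'" "q \<cdot>\<^bsub>Y\<^esub> m = q'"
    using pullback_factor[OF pq, of "e \<cdot>\<^bsub>Y\<^esub> p'" q'] p' eM ab e by auto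
  have right: "pullback Y e p p' m"
    using pullback_cancel[OF pq p'q' eM _ m] e ab by simp
  have "e \<cdot>\<^bsub>Y\<^esub> t = p \<cdot>\<^bsub>Y\<^esub> (c \<cdot>\<^bsub>Y\<^esub> s)"
    using ts' c p Cmp_assoc[of s c p] by simp
  then obtain c' where c': "c' \<in> Mor Y" "Dom Y c' = Dom Y t" "Cod Y c' = Dom Y p'"
      "p' \<cdot>\<^bsub>Y\<^esub> c' = t" "m \<cdot>\<^bsub>Y\<^esub> c' = c \<cdot>\<^bsub>Y\<^esub> s"
    using pullback_factor[OF right, of t "c \<cdot>\<^bsub>Y\<^esub> s"] ts' c by auto
  \<comment> \<open>Since \<open>f\<^sub>A = p \<cdot> c\<close>, the square of \<open>c'\<close> over \<open>c\<close> is what remains of the square of \<open>t\<close> over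
    \<open>f\<^sub>A\<close> once that of \<open>p'\<close> over \<open>p\<close> is cancelled.\<close>
  have "pullback Y c m s c'"
  proof (rule pullback_cancel[OF pullback_symmetric[OF right]])
    show "pullback Y (p \<cdot>\<^bsub>Y\<^esub> c) e s t" using pullback_symmetric[OF ts] c by simp
  qed (use c c' m ts' in auto)
  then have "c' \<in> \<E>" by (rule pullback_ext[OF c(5) pullback_symmetric])
  moreover have "trivial_covering Y L \<eta> \<E> (p' \<cdot>\<^bsub>Y\<^esub> c')" using triv c' by simp
  ultimately have "trivial_covering Y L \<eta> \<E> p'"
    using trivial_covering_left_factor[OF sB _ p'E] c' by blast
  then show ?thesis
    using fB abe p'q' by (auto simp: covering_def)
qed

end

theorem proposition4p7:
  fixes Y X :: "('o, 'm) cat" and L :: "('o, 'm, 'o, 'm) ftor"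
    and \<eta> \<epsilon> :: "'o \<Rightarrow> 'm" and \<E> :: "'m set"
    and a\<^sub>t a\<^sub>b f\<^sub>A f\<^sub>B :: 'm
  assumes "galois_structure Y X L \<eta> \<epsilon> \<E>"
    and "strongly_Birkhoff Y L \<eta> \<E>"
    and "double_extension Y \<E> a\<^sub>t a\<^sub>b f\<^sub>A f\<^sub>B"
    and "covering Y L \<eta> \<E> f\<^sub>A"
  shows "covering Y L \<eta> \<E> f\<^sub>B"
  using galois_structure.covering_double_extension_quotient[OF assms] .

end
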